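(* Let $T:V\to\mathfrak g$ be a relative Rota-Baxter operator on an $n$-LieRep pair $(\mathfrak g,[-,\cdots,-]_{\mathfrak g};\rho)$. Then for a linear map $T':V\to\mathfrak g$, $T+T'$ is a relative Rota-Baxter operator (on the same $n$-LieRep pair) if and only if $T'$ is a Maurer-Cartan element of the twisted $L_\infty$-algebra $(C^*(V,\mathfrak g),l_1^T,\cdots,l_n^T)$, that is, $T'$ satisfies the Maurer-Cartan equation $$l_1^T(T')+\frac12l_2^T(T',T')+\frac1{3!}l_3^T(T',T',T')+\cdots+\frac1{n!}l_n^T(\underbrace{T',\cdots,T'}_n)=0.$$
   Context: All vector spaces are finite dimensional over an algebraically closed field $\mathbb K$ of characteristic $0$; $n\ge 2$ is an integer; a hat denotes omission. An $n$-Lie algebra is a vector space $\mathfrak g$ with a skew-symmetric linear map $\mu=[-,\cdots,-]_{\mathfrak g}:\wedge^n\mathfrak g\to\mathfrak g$ such that $[x_1,\cdots,x_{n-1},[y_1,\cdots,y_n]]=\sum_{i=1}^n[y_1,\cdots,y_{i-1},[x_1,\cdots,x_{n-1},y_i],y_{i+1},\cdots,y_n]$. A representation of it on $V$ is a linear map $\rho:\wedge^{n-1}\mathfrak g\to\mathfrak{gl}(V)$ with (1) $[\rho(\mathfrak X),\rho(\mathfrak Y)]=\rho(\mathfrak X\circ\mathfrak Y)$ (commutator on the left), where for $\mathfrak X=x_1\wedge\cdots\wedge x_{n-1}$, $\mathfrak Y=y_1\wedge\cdots\wedge y_{n-1}$, $\mathfrak X\circ\mathfrak Y=\sum_{i=1}^{n-1}y_1\wedge\cdots\wedge[x_1,\cdots,x_{n-1},y_i]_{\mathfrak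 g}\wedge\cdots\wedge y_{n-1}$; and (2) $\rho(x_1,\cdots,x_{n-2},[y_1,\cdots,y_n]_{\mathfrak g})=\sum_{i=1}^n(-1)^{n-i}\rho(y_1,\cdots,\widehat{y_i},\cdots,y_n)\rho(x_1,\cdots,x_{n-2},y_i)$. An $n$-LieRep pair $(\mathfrak g,[-,\cdots,-]_{\mathfrak g};\rho)$ is an $n$-Lie algebra together with a representation $\rho$ on a vector space $V$. A relative Rota-Baxter operator on the $n$-LieRep pair is a linear map $T:V\to\mathfrak g$ with $[Tv_1,\cdots,Tv_n]_{\mathfrak g}=\sum_{i=1}^n(-1)^{n-i}T(\rho(Tv_1,\cdots,\widehat{Tv_i},\cdots,Tv_n)(v_i))$ for all $v_i\in V$. For a vector space $W$, $\otimes^p(\wedge^{n-1}W)\wedge W$ means $W$ if $p=0$ and $\otimes^{p-1}(\wedge^{n-1}W)\otimes\wedge^nW$ if $p\ge1$; a map on it is written $P(\mathfrak X_1,\cdots,\mathfrak X_p,x)$ with $\mathfrak X_i\in\wedge^{n-1}W$, $x\in W$. Put $C^p(W,W)=\mathrm{Hom}(\otimes^p(\wedge^{n-1}W)\wedge W,W)$ (degree $p$). $\bigoplus_{p\ge0}C^p(W,W)$ is a graded Lie algebra under $[P,Q]_{n\text{-Lie}}=P\circ Q-(-1)^{pq}Q\circ P$ for $P\in C^p$, $Q\in C^q$, where, with $\mathfrak X_i=x_i^1\wedge\cdots\wedge x_i^{n-1}$, $$(P\circ Q)(\mathfrak X_1,\cdots,\mathfrak X_{p+q},x)=\sum_{k=1}^p(-1)^{(k-1)q}\sum_{\sigma\in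 S(k-1,q)}(-1)^\sigma\sum_{i=1}^{n-1}P(\mathfrak X_{\sigma(1)},\cdots,\mathfrak X_{\sigma(k-1)},x_{k+q}^1\wedge\cdots\wedge x_{k+q}^{i-1}\wedge Q(\mathfrak X_{\sigma(k)},\cdots,\mathfrak X_{\sigma(k+q-1)},x_{k+q}^i)\wedge x_{k+q}^{i+1}\wedge\cdots\wedge x_{k+q}^{n-1},\mathfrak X_{k+q+1},\cdots,\mathfrak X_{p+q},x)$$ $$+\sum_{\sigma\in S(p,q)}(-1)^{pq}(-1)^\sigma P(\mathfrak X_{\sigma(1)},\cdots,\mathfrak X_{\sigma(p)},Q(\mathfrak X_{\sigma(p+1)},\cdots,\mathfrak X_{\sigma(p+q)},x)),$$ and $S(i,j)$ is the set of $(i,j)$-shuffles. Let $C^m(V,\mathfrak g)=\mathrm{Hom}(\otimes^m(\wedge^{n-1}V)\wedge V,\mathfrak g)$ (degree $m$), $C^*(V,\mathfrak g)=\bigoplus_{m\ge0}C^m(V,\mathfrak g)$, viewed inside $\bigoplus_mC^m(W,W)$ with $W=\mathfrak g\oplus V$ by applying $P$ to the $V$-components of the arguments. Let $\mu+\rho\in C^1(W,W)$ be the map $(x_1+u_1,\cdots,x_n+u_n)\mapsto[x_1,\cdots,x_n]_{\mathfrak g}+\sum_{i=1}^n(-1)^{n-i}\rho(x_1,\cdots,\widehat{x_i},\cdots,x_n)(u_i)$. The $n$-ary bracket $\{P_1,\cdots,P_n\}=[\cdots[[\mu+\rho,P_1]_{n\text{-Lie}},P_2]_{n\text{-Lie}},\cdots,P_n]_{n\text{-Lie}}$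 makes $C^*(V,\mathfrak g)$ a Lie $n$-algebra (an $L_\infty$-algebra with only the $n$-ary bracket nonzero, with graded symmetric brackets of degree $1$) whose Maurer-Cartan elements (degree $0$ elements $\alpha$ with $\frac1{n!}\{\alpha,\cdots,\alpha\}=0$) are the relative Rota-Baxter operators. Twisting by the Maurer-Cartan element $T$ gives the $L_\infty$-algebra with brackets $$l_k^T(P_1,\cdots,P_k)=\frac1{(n-k)!}\{\underbrace{T,\cdots,T}_{n-k},P_1,\cdots,P_k\}\ (1\le k\le n),\qquad l_k^T=0\ (k\ge n+1).$$ A Maurer-Cartan element of an $L_\infty$-algebra $(L,\{l_k\})$ is a degree $0$ element $\alpha$ with $\sum_{k\ge1}\frac1{k!}l_k(\alpha,\cdots,\alpha)=0$. *)

theory Defs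
  imports
    "HOL-Analysis.Product_Vector"
    "HOL-Combinatorics.Permutations"
    "HOL-Library.Function_Algebras"
    "HOL-Computational_Algebra.Polynomial"
begin

text \<open>
  A linear map out of an exterior power is represented by the alternating multilinear map
  it induces on decomposable elements: \<open>x\<^sub>1 \<and> \<dots> \<and> x\<^sub>m\<close> is given by the list
  \<open>[x\<^sub>1, \<dots>, x\<^sub>m]\<close>. List positions are counted from 0, so the sign \<open>(-1)\<^sup>n\<^sup>-\<^sup>i\<close> belonging
  to the \<open>i\<close>-th argument (counted from 1) becomes \<open>(-1) ^ (n - Suc i)\<close>.
\<close>

definition alt_multilinear ::
  "('k::field \<Rightarrow> 'a::ab_group_add \<Rightarrow> 'a) \<Rightarrow> ('k \<Rightarrow> 'b::ab_group_add \<Rightarrow> 'b) \<Rightarrow> nat \<Rightarrow> ('a list \<Rightarrow> 'b) \<Rightarrow> bool"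
where
  "alt_multilinear sa sb m f \<longleftrightarrow>
     (\<forall>xs i. length xs = m \<and> i < m \<longrightarrow> Vector_Spaces.linear sa sb (\<lambda>y. f (xs[i := y]))) \<and>
     (\<forall>xs i j. length xs = m \<and> i < j \<and> j < m \<and> xs ! i = xs ! j \<longrightarrow> f xs = 0)"

definition omit :: "nat \<Rightarrow> 'a list \<Rightarrow> 'a list" where
  "omit i xs = take i xs @ drop (Suc i) xs"


definition n_Lie_algebra ::
  "nat \<Rightarrow> ('k::field \<Rightarrow> 'g::ab_group_add \<Rightarrow> 'g) \<Rightarrow> ('g list \<Rightarrow> 'g) \<Rightarrow> bool"
where
  "n_Lie_algebra n sg mu \<longleftrightarrow>
     vector_space sg \<and> alt_multilinear sg sg n mu \<and>
     (\<forall>xs ys. length xs = n - 1 \<and> length ys = n \<longrightarrow>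
        mu (xs @ [mu ys]) = (\<Sum>i<n. mu (ys[i := mu (xs @ [ys ! i])])))"

definition n_Lie_representation ::
  "nat \<Rightarrow> ('k::field \<Rightarrow> 'g::ab_group_add \<Rightarrow> 'g) \<Rightarrow> ('g list \<Rightarrow> 'g) \<Rightarrow>
   ('k \<Rightarrow> 'v::ab_group_add \<Rightarrow> 'v) \<Rightarrow> ('g list \<Rightarrow> 'v \<Rightarrow> 'v) \<Rightarrow> bool"
where
  "n_Lie_representation n sg mu sv rho \<longleftrightarrow>
     vector_space sv \<and>
     (\<forall>xs. length xs = n - 1 \<longrightarrow> Vector_Spaces.linear sv sv (rho xs)) \<and>
     (\<forall>v. alt_multilinear sg sv (n - 1) (\<lambda>xs. rho xs v)) \<and>
     (\<forall>xs ys v. length xs = n - 1 \<and> length ys = n - 1 \<longrightarrow>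
        rho xs (rho ys v) - rho ys (rho xs v) =
        (\<Sum>i<n - 1. rho (ys[i := mu (xs @ [ys ! i])]) v)) \<and>
     (\<forall>xs ys v. length xs = n - 2 \<and> length ys = n \<longrightarrow>
        rho (xs @ [mu ys]) v =
        (\<Sum>i<n. sv ((-1) ^ (n - Suc i)) (rho (omit i ys) (rho (xs @ [ys ! i]) v))))"

definition n_LieRep_pair ::
  "nat \<Rightarrow> ('k::field \<Rightarrow> 'g::ab_group_add \<Rightarrow> 'g) \<Rightarrow> ('g list \<Rightarrow> 'g) \<Rightarrow>
   ('k \<Rightarrow> 'v::ab_group_add \<Rightarrow> 'v) \<Rightarrow> ('g list \<Rightarrow> 'v \<Rightarrow> 'v) \<Rightarrow> bool"
where
  "n_LieRep_pair n sg mu sv rho \<longleftrightarrow>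
     n_Lie_algebra n sg mu \<and> n_Lie_representation n sg mu sv rho"

definition relative_Rota_Baxter ::
  "nat \<Rightarrow> ('k::field \<Rightarrow> 'g::ab_group_add \<Rightarrow> 'g) \<Rightarrow> ('g list \<Rightarrow> 'g) \<Rightarrow>
   ('k \<Rightarrow> 'v::ab_group_add \<Rightarrow> 'v) \<Rightarrow> ('g list \<Rightarrow> 'v \<Rightarrow> 'v) \<Rightarrow> ('v \<Rightarrow> 'g) \<Rightarrow> bool"
where
  "relative_Rota_Baxter n sg mu sv rho T \<longleftrightarrow>
     Vector_Spaces.linear sv sg T \<and>
     (\<forall>vs. length vs = n \<longrightarrow>
        mu (map T vs) =
        (\<Sum>i<n. sg ((-1) ^ (n - Suc i)) (T (rho (omit i (map T vs)) (vs ! i)))))"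


text \<open>
  A cochain \<open>P(\<XX>\<^sub>1, \<dots>, \<XX>\<^sub>p, x)\<close> takes the list of its blocks \<open>\<XX>\<^sub>i\<close> (each a list of
  length \<open>n - 1\<close>) and the last argument \<open>x\<close>. Cochains vanish on ill-shaped arguments, so
  that equality of functions is equality of linear maps. For \<open>p \<ge> 1\<close> the last block
  together with \<open>x\<close> forms a factor \<open>\<and>\<^sup>n\<close>.
\<close>

type_synonym ('a, 'b) cochain = "'a list list \<Rightarrow> 'a \<Rightarrow> 'b"

definition blocks :: "nat \<Rightarrow> nat \<Rightarrow> 'a list list \<Rightarrow> bool" where
  "blocks n p Xs \<longleftrightarrow> length Xs = p \<and> (\<forall>X\<in>set Xs. length X = n - 1)"

definition cochains ::
  "nat \<Rightarrow> ('k::field \<Rightarrow> 'a::ab_group_add \<Rightarrow> 'a) \<Rightarrow> ('k \<Rightarrow> 'b::ab_group_add \<Rightarrow> 'b) \<Rightarrow> nat \<Rightarrow>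
   ('a, 'b) cochain set"
where
  "cochains n sa sb p = {P.
     (\<forall>Xs x. \<not> blocks n p Xs \<longrightarrow> P Xs x = 0) \<and>
     (\<forall>Xs. blocks n p Xs \<longrightarrow> Vector_Spaces.linear sa sb (P Xs)) \<and>
     (\<forall>Xs x k. blocks n p Xs \<and> k < p \<longrightarrow>
        alt_multilinear sa sb (n - 1) (\<lambda>X. P (Xs[k := X]) x)) \<and>
     (\<forall>Xs. 1 \<le> p \<and> blocks n (p - 1) Xs \<longrightarrow>
        alt_multilinear sa sb n (\<lambda>Y. P (Xs @ [butlast Y]) (last Y)))}"

definition shuffle_perms :: "nat \<Rightarrow> nat \<Rightarrow> (nat \<Rightarrow> nat) set" where
  "shuffle_perms i j =
     {\<sigma>. \<sigma> permutes {1..i + j} \<and> strict_mono_on {1..i} \<sigma> \<and> strict_mono_on {i + 1..i + j} \<sigma>}"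

text \<open>
  In the pre-Lie product below blocks are numbered from 1, so that \<open>X i\<close> is \<open>\<XX>\<^sub>i\<close>; positions
  inside a block are numbered from 0.
\<close>

definition circ ::
  "nat \<Rightarrow> ('k::field \<Rightarrow> 'w::ab_group_add \<Rightarrow> 'w) \<Rightarrow> nat \<Rightarrow> nat \<Rightarrow>
   ('w, 'w) cochain \<Rightarrow> ('w, 'w) cochain \<Rightarrow> ('w, 'w) cochain"
where
  "circ n s p q P Q = (\<lambda>Xs x.
     if blocks n (p + q) Xs then
       let X = (\<lambda>i. Xs ! (i - 1)) in
         (\<Sum>k = 1..p. s ((-1) ^ ((k - 1) * q))
            (\<Sum>\<sigma>\<in>shuffle_perms (k - 1) q. s (of_int (sign \<sigma>))
               (\<Sum>i<n - 1.
                  P (map (\<lambda>j. X (\<sigma> j)) [1..<k]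
                     @ [(X (k + q))[i := Q (map (\<lambda>j. X (\<sigma> j)) [k..<k + q]) (X (k + q) ! i)]]
                     @ map X [k + q + 1..<p + q + 1]) x)))
         + (\<Sum>\<sigma>\<in>shuffle_perms p q. s ((-1) ^ (p * q)) (s (of_int (sign \<sigma>))
              (P (map (\<lambda>j. X (\<sigma> j)) [1..<p + 1])
                 (Q (map (\<lambda>j. X (\<sigma> j)) [p + 1..<p + q + 1]) x))))
     else 0)"

definition hom_bracket ::
  "nat \<Rightarrow> ('k::field \<Rightarrow> 'w::ab_group_add \<Rightarrow> 'w) \<Rightarrow> nat \<Rightarrow> nat \<Rightarrow>
   ('w, 'w) cochain \<Rightarrow> ('w, 'w) cochain \<Rightarrow> ('w, 'w) cochain"
where
  "hom_bracket n s p q P Q =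
     (\<lambda>Xs x. circ n s p q P Q Xs x - s ((-1) ^ (p * q)) (circ n s q p Q P Xs x))"


text \<open>
  An element of \<open>\<Oplus>\<^sub>p C\<^sup>p\<close> is the family of its homogeneous components, on which the
  bracket is extended bilinearly; addition and zero are the pointwise ones.
\<close>

type_synonym ('a, 'b) graded = "nat \<Rightarrow> ('a, 'b) cochain"

definition homogeneous :: "nat \<Rightarrow> ('a, 'b::zero) cochain \<Rightarrow> ('a, 'b) graded" where
  "homogeneous p P = (\<lambda>r. if r = p then P else 0)"

definition graded_scale :: "('k \<Rightarrow> 'b \<Rightarrow> 'b) \<Rightarrow> 'k \<Rightarrow> ('a, 'b) graded \<Rightarrow> ('a, 'b) graded" where
  "graded_scale s c F = (\<lambda>p Xs x. s c (F p Xs x))"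

definition nLie_bracket ::
  "nat \<Rightarrow> ('k::field \<Rightarrow> 'w::ab_group_add \<Rightarrow> 'w) \<Rightarrow>
   ('w, 'w) graded \<Rightarrow> ('w, 'w) graded \<Rightarrow> ('w, 'w) graded"
where
  "nLie_bracket n s F G = (\<lambda>r. \<Sum>p\<le>r. hom_bracket n s p (r - p) (F p) (G (r - p)))"


text \<open>The space \<open>W = \<gg> \<oplus> V\<close> is the product type, with \<^const>\<open>module_prod.scale\<close>.\<close>

definition embed_cochain ::
  "('v, 'g) cochain \<Rightarrow> ('g \<times> 'v, 'g \<times> 'v::zero) cochain"
where
  "embed_cochain P = (\<lambda>Xs w. (P (map (map snd) Xs) (snd w), 0))"

definition C_star ::
  "nat \<Rightarrow> ('k::field \<Rightarrow> 'g::ab_group_add \<Rightarrow> 'g) \<Rightarrow> ('k \<Rightarrow> 'v::ab_group_add \<Rightarrow> 'v) \<Rightarrow>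
   nat \<Rightarrow> ('g \<times> 'v, 'g \<times> 'v) graded set"
where
  "C_star n sg sv m = (\<lambda>P. homogeneous m (embed_cochain P)) ` cochains n sv sg m"

definition linear_element ::
  "('v \<Rightarrow> 'g::zero) \<Rightarrow> ('g \<times> 'v, 'g \<times> 'v::zero) graded"
where
  "linear_element T = homogeneous 0 (embed_cochain (\<lambda>Xs v. if Xs = [] then T v else 0))"

definition semidirect ::
  "nat \<Rightarrow> ('g::ab_group_add list \<Rightarrow> 'g) \<Rightarrow> ('k::field \<Rightarrow> 'v::ab_group_add \<Rightarrow> 'v) \<Rightarrow>
   ('g list \<Rightarrow> 'v \<Rightarrow> 'v) \<Rightarrow> ('g \<times> 'v, 'g \<times> 'v) graded"
where
  "semidirect n mu sv rho = homogeneous 1 (\<lambda>Xs w.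
     if blocks n 1 Xs then
       let ws = hd Xs @ [w] in
         (mu (map fst ws),
          \<Sum>i<n. sv ((-1) ^ (n - Suc i)) (rho (omit i (map fst ws)) (snd (ws ! i))))
     else 0)"

definition n_bracket ::
  "nat \<Rightarrow> ('k::field \<Rightarrow> 'g::ab_group_add \<Rightarrow> 'g) \<Rightarrow> ('g list \<Rightarrow> 'g) \<Rightarrow>
   ('k \<Rightarrow> 'v::ab_group_add \<Rightarrow> 'v) \<Rightarrow> ('g list \<Rightarrow> 'v \<Rightarrow> 'v) \<Rightarrow>
   ('g \<times> 'v, 'g \<times> 'v) graded list \<Rightarrow> ('g \<times> 'v, 'g \<times> 'v) graded"
where
  "n_bracket n sg mu sv rho Ps =
     foldl (nLie_bracket n (module_prod.scale sg sv)) (semidirect n mu sv rho) Ps"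

definition twisted_bracket ::
  "nat \<Rightarrow> ('k::field_char_0 \<Rightarrow> 'g::ab_group_add \<Rightarrow> 'g) \<Rightarrow> ('g list \<Rightarrow> 'g) \<Rightarrow>
   ('k \<Rightarrow> 'v::ab_group_add \<Rightarrow> 'v) \<Rightarrow> ('g list \<Rightarrow> 'v \<Rightarrow> 'v) \<Rightarrow> ('v \<Rightarrow> 'g) \<Rightarrow>
   nat \<Rightarrow> ('g \<times> 'v, 'g \<times> 'v) graded list \<Rightarrow> ('g \<times> 'v, 'g \<times> 'v) graded"
where
  "twisted_bracket n sg mu sv rho T k Ps =
     (if 1 \<le> k \<and> k \<le> n \<and> length Ps = k then
        graded_scale (module_prod.scale sg sv) (1 / fact (n - k))
          (n_bracket n sg mu sv rho (replicate (n - k) (linear_element T) @ Ps))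
      else 0)"

text \<open>
  Maurer-Cartan elements of an \<open>L\<^sub>\<infinity>\<close>-algebra with homogeneous parts \<open>L m\<close>, scalar
  multiplication \<open>s\<close> and brackets \<open>l k\<close>. There is no topology: the series over all
  \<open>k \<ge> 1\<close> is required to have only finitely many nonzero terms.
\<close>

definition Maurer_Cartan_element ::
  "('k::field_char_0 \<Rightarrow> 'a::ab_group_add \<Rightarrow> 'a) \<Rightarrow> (nat \<Rightarrow> 'a set) \<Rightarrow> (nat \<Rightarrow> 'a list \<Rightarrow> 'a) \<Rightarrow> 'a \<Rightarrow> bool"
where
  "Maurer_Cartan_element s L l \<alpha> \<longleftrightarrow>
     \<alpha> \<in> L 0 \<and>
     (let t = (\<lambda>k. s (1 / fact k) (l k (replicate k \<alpha>)));
          K = {k. 1 \<le> k \<and> t k \<noteq> 0}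
      in finite K \<and> (\<Sum>k\<in>K. t k) = 0)"

end

theory Submission
  imports Defs
begin

text \<open>
  Write \<open>f = \<mu> + \<rho>\<close>, and for a linear map \<open>T : V \<rightarrow> \<gg>\<close> write \<open>D\<^sub>T\<close> for the operator
  \<open>x + u \<mapsto> T u\<close> of \<open>W = \<gg> \<oplus> V\<close>. All brackets in the Maurer-Cartan equation of \<open>T'\<close> start from
  \<open>f\<close>, of degree 1, and insert elements of degree 0. Between these degrees the graded bracket
  contains no shuffles: \<open>[f, D]\<close> is the usual action of an operator \<open>D\<close> on multilinear maps, up
  to sign, namely \<open>ad D f (w\<^sub>1, \<dots>, w\<^sub>n) = (\<Sum>i. f (\<dots>, D w\<^sub>i, \<dots>)) - D (f (w\<^sub>1, \<dots>, w\<^sub>n))\<close>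
  (\<open>nLie_bracket_degree_one\<close>). So the equation is about powers of \<open>ad D\<^sub>T\<close> and \<open>ad D\<^sub>T\<^sub>'\<close>.
  
  Since \<open>D\<^sub>T D\<^sub>T\<^sub>' = 0 = D\<^sub>T\<^sub>' D\<^sub>T\<close>, these two operators commute, and the binomial theorem
  (\<open>ad_add_power\<close>) gives
  \<open>\<Sum>k\<le>n. (ad D\<^sub>T\<^sub>')\<^sup>k (ad D\<^sub>T)\<^sup>n\<^sup>-\<^sup>k f / (k! (n - k)!) = (ad D\<^sub>S)\<^sup>n f / n!\<close> where \<open>S = T + T'\<close>.
  The left side of the Maurer-Cartan equation is this sum without its term \<open>k = 0\<close>, hence equals
  \<open>((ad D\<^sub>S)\<^sup>n f - (ad D\<^sub>T)\<^sup>n f) / n!\<close>.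
  
  It remains to see that \<open>(ad D\<^sub>T)\<^sup>n f / n!\<close> measures the failure of \<open>T\<close> to be a relative
  Rota-Baxter operator (\<open>ad_power_semidirect_map\<close>). As \<open>D = D\<^sub>T\<close> has square zero, the surviving
  terms of \<open>(ad D)\<^sup>n f\<close> apply \<open>D\<close> to distinct arguments, and to the result at most once. Either all \<open>n\<close>
  arguments are hit, which gives \<open>[T v\<^sub>1, \<dots>, T v\<^sub>n]\<close>, or all but the \<open>i\<close>-th and then the result,
  which gives \<open>T (\<rho> (T v\<^sub>1, \<dots>, T v\<^sub>n) v\<^sub>i)\<close> with \<open>T v\<^sub>i\<close> omitted, up to sign
  (\<open>ad_power_length\<close>). For the given \<open>T\<close> this expression vanishes, so the equation for \<open>T'\<close> says
  precisely that it vanishes for \<open>T + T'\<close>.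
\<close>

section \<open>The action of an operator on multiadditive maps\<close>

text \<open>
  A multilinear map of \<open>n\<close> arguments is regarded as a function on lists of all lengths that is
  zero off length \<open>n\<close>. Additivity can then be stated for all lists at once, and identities
  between such maps become equalities of functions.
\<close>

definition multiadditive :: "('w::ab_group_add list \<Rightarrow> 'u::ab_group_add) \<Rightarrow> bool" where
  "multiadditive f \<longleftrightarrow> (\<forall>ws i x y. i < length ws \<longrightarrow> f (ws[i := x + y]) = f (ws[i := x]) + f (ws[i := y]))"

lemma multiadditiveD:
  "multiadditive f \<Longrightarrow> i < length ws \<Longrightarrow> f (ws[i := x + y]) = f (ws[i := x]) + f (ws[i := y])"
  by (simp add: multiadditive_def)

lemma multiadditive_zero:
  assumes "multiadditive f" "0 \<in> set ws"
  shows "f ws = 0"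
proof -
  obtain i where i: "i < length ws" "ws ! i = 0"
    using assms(2) by (auto simp: in_set_conv_nth)
  have "f (ws[i := 0 + 0]) = f (ws[i := 0]) + f (ws[i := 0])"
    using assms(1) i(1) by (rule multiadditiveD)
  moreover have "ws[i := 0] = ws"
    using i by (metis list_update_id)
  ultimately show ?thesis by simp
qed

definition substitute_each :: "('w \<Rightarrow> 'w) \<Rightarrow> ('w list \<Rightarrow> 'u::comm_monoid_add) \<Rightarrow> 'w list \<Rightarrow> 'u" where
  "substitute_each D f ws = (\<Sum>i<length ws. f (ws[i := D (ws ! i)]))"

text \<open>
  For a multilinear \<open>f\<close> this is the derivative at \<open>t = 0\<close> of
  \<open>e\<^sup>-\<^sup>t\<^sup>D f (e\<^sup>t\<^sup>D w\<^sub>1, \<dots>, e\<^sup>t\<^sup>D w\<^sub>n)\<close>, so its powers are, up to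
  factorials, the Taylor coefficients of the transported map.
\<close>

definition ad :: "('w \<Rightarrow> 'w) \<Rightarrow> ('w list \<Rightarrow> 'w::ab_group_add) \<Rightarrow> 'w list \<Rightarrow> 'w" where
  "ad D f ws = substitute_each D f ws - D (f ws)"

lemma multiadditive_ad:
  assumes f: "multiadditive f" and D: "additive D"
  shows "multiadditive (ad D f)"
  unfolding multiadditive_def
proof (intro allI impI)
  interpret additive D by fact
  fix ws :: "'a list" and i x y assume i: "i < length ws"
  have "f (ws[i := x + y, j := D (ws[i := x + y] ! j)])
      = f (ws[i := x, j := D (ws[i := x] ! j)]) + f (ws[i := y, j := D (ws[i := y] ! j)])"
    if "j < length ws" for j
  proof (cases "j = i")
    case True
    then show ?thesis using i by (simp add: add multiadditiveD[OF f])
  next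
    case False
    then show ?thesis using i
      by (simp add: list_update_swap[of i j] multiadditiveD[OF f])
  qed
  then have "substitute_each D f (ws[i := x + y])
      = substitute_each D f (ws[i := x]) + substitute_each D f (ws[i := y])"
    by (simp add: substitute_each_def sum.distrib)
  then show "ad D f (ws[i := x + y]) = ad D f (ws[i := x]) + ad D f (ws[i := y])"
    by (simp add: ad_def multiadditiveD[OF f i] add)
qed

lemma multiadditive_ad_power:
  "multiadditive f \<Longrightarrow> additive D \<Longrightarrow> multiadditive ((ad D ^^ m) f)"
  by (induction m) (auto intro: multiadditive_ad)

text \<open>
  Hitting an argument with \<open>D\<close> and then an argument with \<open>E\<close> gives a double sum over positions.
  Exchanging the two sums matches it with the opposite order: off the diagonal the two changes are
  in different places, on the diagonal they meet as \<open>D (E w) = E (D w)\<close>.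
\<close>

lemma ad_commute:
  assumes D: "additive D" and E: "additive E" and comm: "\<And>w. D (E w) = E (D w)"
  shows "ad D (ad E f) = ad E (ad D f)"
proof
  fix ws :: "'a list"
  interpret D: additive D by fact
  interpret E: additive E by fact
  let ?n = "length ws"
  have "(\<Sum>i<?n. \<Sum>j<?n. f (ws[i := D (ws ! i), j := E (ws[i := D (ws ! i)] ! j)]))
      = (\<Sum>j<?n. \<Sum>i<?n. f (ws[i := D (ws ! i), j := E (ws[i := D (ws ! i)] ! j)]))"
    by (rule sum.swap)
  also have "\<dots> = (\<Sum>j<?n. \<Sum>i<?n. f (ws[j := E (ws ! j), i := D (ws[j := E (ws ! j)] ! i)]))"
  proof (intro sum.cong refl)
    fix i j assume "i \<in> {..<?n}" "j \<in> {..<?n}"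
    then show "f (ws[i := D (ws ! i), j := E (ws[i := D (ws ! i)] ! j)])
        = f (ws[j := E (ws ! j), i := D (ws[j := E (ws ! j)] ! i)])"
      by (cases "i = j") (simp_all add: comm list_update_swap[of i j])
  qed
  finally show "ad D (ad E f) ws = ad E (ad D f) ws"
    by (simp add: ad_def substitute_each_def sum_subtractf D.sum E.sum D.diff E.diff comm)
qed

lemma ad_add:
  assumes "multiadditive f"
  shows "ad (\<lambda>w. D w + E w) f = ad D f + ad E f"
  by (rule ext)
    (simp add: ad_def substitute_each_def sum.distrib multiadditiveD[OF assms] algebra_simps)

section \<open>The binomial expansion of a power of a sum\<close>

text \<open>
  The operators \<open>ad D\<close> act on this space of functions, where the binomial theorem for commuting
  linear operators will be applied to them.
\<close>

lemma (in vector_space) vector_space_fun: "vector_space (\<lambda>c f x. scale c (f x))"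
  by unfold_locales (auto simp: fun_eq_iff algebra_simps)

lemma linear_ad:
  assumes "Vector_Spaces.linear s s D"
  shows "Vector_Spaces.linear (\<lambda>c f ws. s c (f ws)) (\<lambda>c f ws. s c (f ws)) (ad D)"
proof -
  interpret Vector_Spaces.linear s s D by fact
  show ?thesis
    unfolding Vector_Spaces.linear_iff
    by (auto simp: vs1.vector_space_fun fun_eq_iff ad_def substitute_each_def sum.distrib add scale
        vs1.scale_sum_right vs1.scale_right_diff_distrib algebra_simps)
qed

lemma binomial_commuting_linear:
  assumes A: "Vector_Spaces.linear s s A" and B: "Vector_Spaces.linear s s B"
    and comm: "\<And>x. A (B x) = B (A x)"
  shows "((\<lambda>x. A x + B x) ^^ m) x = (\<Sum>k\<le>m. s (of_nat (m choose k)) ((A ^^ k) ((B ^^ (m - k)) x)))"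
proof (induction m)
  case 0
  interpret Vector_Spaces.linear s s A by fact
  show ?case by simp
next
  case (Suc m)
  interpret A: Vector_Spaces.linear s s A by fact
  interpret B: Vector_Spaces.linear s s B by fact
  define t where "t k l = (A ^^ k) ((B ^^ l) x)" for k l
  have tA: "A (t k l) = t (Suc k) l" for k l
    by (simp add: t_def)
  have "B ((A ^^ k) z) = (A ^^ k) (B z)" for k z
    by (induction k) (simp_all flip: comm)
  then have tB: "B (t k l) = t k (Suc l)" for k l
    by (simp add: t_def)
  define u where "u k = t k (Suc m - k)" for k
  have a: "A (s (of_nat (m choose k)) (t k (m - k))) = s (of_nat (m choose k)) (u (Suc k))" for k
    by (simp add: A.scale tA u_def)
  have b: "B (s (of_nat (m choose k)) (t k (m - k))) = s (of_nat (m choose k)) (u k)" if "k \<le> m" for k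
    using that by (simp add: B.scale tB u_def Suc_diff_le)
  have "((\<lambda>x. A x + B x) ^^ Suc m) x = (\<Sum>k\<le>m. s (of_nat (m choose k)) (u (Suc k)))
      + (\<Sum>k\<le>m. s (of_nat (m choose k)) (u k))"
    using Suc.IH by (simp add: A.sum B.sum a b flip: t_def)
  also have "(\<Sum>k\<le>m. s (of_nat (m choose k)) (u k)) = (\<Sum>k\<le>Suc m. s (of_nat (m choose k)) (u k))"
    by (simp add: binomial_eq_0)
  also have "\<dots> = u 0 + (\<Sum>k\<le>m. s (of_nat (m choose Suc k)) (u (Suc k)))"
    by (subst sum.atMost_Suc_shift) simp
  also have "(\<Sum>k\<le>m. s (of_nat (m choose k)) (u (Suc k)))
       + (u 0 + (\<Sum>k\<le>m. s (of_nat (m choose Suc k)) (u (Suc k))))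
     = u 0 + (\<Sum>k\<le>m. s (of_nat (Suc m choose Suc k)) (u (Suc k)))"
    by (simp add: sum.distrib A.vs1.scale_left_distrib add_ac)
  also have "\<dots> = (\<Sum>k\<le>Suc m. s (of_nat (Suc m choose k)) (u k))"
    by (subst sum.atMost_Suc_shift) simp
  finally show ?case by (simp add: u_def t_def)
qed

lemma sum_apply: "sum F A x = (\<Sum>a\<in>A. F a x)" for F :: "'a \<Rightarrow> 'b \<Rightarrow> 'c::comm_monoid_add"
  by (induction A rule: infinite_finite_induct) simp_all

text \<open>
  \<open>ad (D + E) = ad D + ad E\<close> holds on multiadditive maps only. It can be used at every stage of
  the power because \<open>ad\<close> preserves multiadditivity.
\<close>

lemma ad_add_power:
  assumes f: "multiadditive f" and D: "Vector_Spaces.linear s s D" and E: "Vector_Spaces.linear s s E"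
    and comm: "\<And>w. D (E w) = E (D w)"
  shows "(ad (\<lambda>w. D w + E w) ^^ m) f ws
    = (\<Sum>k\<le>m. s (of_nat (m choose k)) ((ad D ^^ k) ((ad E ^^ (m - k)) f) ws))"
proof -
  interpret D: Vector_Spaces.linear s s D by fact
  interpret E: Vector_Spaces.linear s s E by fact
  have addD: "additive D" "additive E" "additive (\<lambda>w. D w + E w)"
    by (simp_all add: additive_def D.add E.add algebra_simps)
  have "(ad (\<lambda>w. D w + E w) ^^ m) f = ((\<lambda>g. ad D g + ad E g) ^^ m) f"
  proof (induction m)
    case (Suc m)
    have "(ad (\<lambda>w. D w + E w) ^^ Suc m) f = ad D ((ad (\<lambda>w. D w + E w) ^^ m) f) + ad E ((ad (\<lambda>w. D w + E w) ^^ m) f)"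
      using ad_add[OF multiadditive_ad_power[OF f addD(3)]] by simp
    then show ?case using Suc.IH by simp
  qed simp
  also have "\<dots> = (\<Sum>k\<le>m. (\<lambda>ws. s (of_nat (m choose k)) ((ad D ^^ k) ((ad E ^^ (m - k)) f) ws)))"
    by (rule binomial_commuting_linear[OF linear_ad[OF D] linear_ad[OF E] ad_commute[OF addD(1,2) comm]])
  finally show ?thesis by (simp add: sum_apply)
qed

section \<open>The top power for an operator of square zero\<close>

definition apply_at :: "nat set \<Rightarrow> ('w \<Rightarrow> 'w) \<Rightarrow> 'w list \<Rightarrow> 'w list" where
  "apply_at S D ws = map (\<lambda>i. if i \<in> S then D (ws ! i) else ws ! i) [0..<length ws]"

lemma length_apply_at [simp]: "length (apply_at S D ws) = length ws"
  by (simp add: apply_at_def)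

lemma nth_apply_at [simp]:
  "i < length ws \<Longrightarrow> apply_at S D ws ! i = (if i \<in> S then D (ws ! i) else ws ! i)"
  by (simp add: apply_at_def)

text \<open>
  A term in which some argument is hit twice contains \<open>D (D w) = 0\<close> as an argument and vanishes. The others are given by
  the set \<open>S\<close> of the positions that are hit, each set arising from \<open>m!\<close> orders.
\<close>

lemma substitute_each_power:
  assumes zero: "\<And>ws. 0 \<in> set ws \<Longrightarrow> f ws = 0" and DD: "\<And>w. D (D w) = 0" and "vector_space s"
  shows "(substitute_each D ^^ m) f ws
    = s (of_nat (fact m)) (\<Sum>S | S \<subseteq> {..<length ws} \<and> card S = m. f (apply_at S D ws))"
proof (induction m arbitrary: ws)
  case 0
  interpret vector_space s by fact
  have "{S. S \<subseteq> {..<length ws} \<and> card S = 0} = {{}}"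
    by (auto simp: finite_subset[of _ "{..<length ws}"] card_eq_0_iff)
  moreover have "apply_at {} D ws = ws"
    by (simp add: list_eq_iff_nth_eq)
  ultimately show ?case by simp
next
  case (Suc m)
  interpret vector_space s by fact
  let ?P = "\<lambda>m. {S. S \<subseteq> {..<length ws} \<and> card S = m}"
  have fin: "finite (?P k)" for k
    by (rule finite_subset[of _ "Pow {..<length ws}"]) auto
  have finS: "finite S" if "S \<subseteq> {..<length ws}" for S
    using that by (rule finite_subset) simp
  have hit: "f (apply_at S D (ws[i := D (ws ! i)])) = (if i \<in> S then 0 else f (apply_at (insert i S) D ws))"
    if "i < length ws" for i S
  proof (cases "i \<in> S")
    case True
    have "apply_at S D (ws[i := D (ws ! i)]) ! i = 0"
      using that True by (simp add: DD)
    then have "0 \<in> set (apply_at S D (ws[i := D (ws ! i)]))"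
      using that by (metis length_apply_at length_list_update nth_mem)
    then show ?thesis using True zero by simp
  next
    case False
    then have "apply_at S D (ws[i := D (ws ! i)]) = apply_at (insert i S) D ws"
      by (intro nth_equalityI) (auto, metis nth_list_update_neq)
    then show ?thesis using False by simp
  qed
  have "(\<Sum>i<length ws. \<Sum>S\<in>?P m. f (apply_at S D (ws[i := D (ws ! i)])))
      = (\<Sum>i<length ws. \<Sum>S\<in>{S\<in>?P m. i \<notin> S}. f (apply_at (insert i S) D ws))"
    using fin by (intro sum.cong refl sum.mono_neutral_cong_right) (auto simp: hit)
  also have "\<dots> = (\<Sum>(i, S)\<in>(SIGMA i:{..<length ws}. {S\<in>?P m. i \<notin> S}). f (apply_at (insert i S) D ws))"
    using fin by (intro sum.Sigma) auto
  \<comment> \<open>A set of size \<open>m + 1\<close> arises by adding to it any one of its \<open>m + 1\<close> elements last.\<close>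
  also have "\<dots> = (\<Sum>(S, i)\<in>(SIGMA S:?P (Suc m). S). f (apply_at S D ws))"
    by (rule sum.reindex_bij_witness[of _ "\<lambda>(S, i). (i, S - {i})" "\<lambda>(i, S). (insert i S, i)"])
      (auto simp: finS insert_absorb)
  also have "\<dots> = (\<Sum>S\<in>?P (Suc m). \<Sum>i\<in>S. f (apply_at S D ws))"
    using fin finS by (intro sum.Sigma[symmetric]) auto
  also have "\<dots> = (\<Sum>S\<in>?P (Suc m). s (of_nat (Suc m)) (f (apply_at S D ws)))"
    by (intro sum.cong refl) (auto simp: sum_constant_scale)
  also have "\<dots> = s (of_nat (Suc m)) (\<Sum>S\<in>?P (Suc m). f (apply_at S D ws))"
    by (simp add: scale_sum_right)
  finally show ?case
    by (simp add: substitute_each_def[of D "(substitute_each D ^^ m) f"] Suc.IH scale_sum_right[symmetric] algebra_simps)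
qed

text \<open>
  \<open>ad D\<close> is the difference of two commuting operators, substitution of \<open>D\<close> into the arguments and
  composition with \<open>D\<close> on the left. The second one has square zero, so the binomial expansion stops
  after two terms.
\<close>

lemma ad_power:
  assumes D: "additive D" and DD: "\<And>w. D (D w) = 0" and s: "vector_space s" and Ds: "\<And>c w. D (s c w) = s c (D w)"
  shows "(ad D ^^ Suc m) f ws
    = (substitute_each D ^^ Suc m) f ws - s (of_nat (Suc m)) (D ((substitute_each D ^^ m) f ws))"
proof (induction m arbitrary: ws)
  case 0
  interpret vector_space s by fact
  show ?case by (simp add: ad_def)
next
  case (Suc m)
  interpret vector_space s by fact
  interpret D: additive D by fact
  let ?L = "\<lambda>m. (substitute_each D ^^ m) f"
  have DL: "D (?L (Suc m) vs) = (\<Sum>i<length vs. D (?L m (vs[i := D (vs ! i)])))" for vs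
    by (simp add: substitute_each_def[of D "?L m"] D.sum)
  have "(ad D ^^ Suc (Suc m)) f ws
      = (\<Sum>i<length ws. ?L (Suc m) (ws[i := D (ws ! i)]) - s (of_nat (Suc m)) (D (?L m (ws[i := D (ws ! i)]))))
        - D (?L (Suc m) ws - s (of_nat (Suc m)) (D (?L m ws)))"
    unfolding funpow.simps(2)[of "Suc m" "ad D"] o_def ad_def[of D "(ad D ^^ Suc m) f"]
      substitute_each_def[of D "(ad D ^^ Suc m) f"] Suc.IH ..
  also have "\<dots> = ?L (Suc (Suc m)) ws - s (of_nat (Suc m)) (D (?L (Suc m) ws)) - D (?L (Suc m) ws)"
    unfolding DL sum_subtractf scale_sum_right[symmetric] D.diff Ds DD
    by (simp add: substitute_each_def[of D "substitute_each D (?L m)"] flip: DL)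
  also have "\<dots> = ?L (Suc (Suc m)) ws - s (of_nat (Suc (Suc m))) (D (?L (Suc m) ws))"
    by (simp add: of_nat_Suc[of "Suc m"] scale_left_distrib algebra_simps del: of_nat_Suc)
  finally show ?case .
qed

text \<open>
  For as many factors as there are arguments, the sets in \<open>substitute_each_power\<close> are explicit: in
  the first term of \<open>ad_power\<close> all positions, in the second one the complements of single positions.
\<close>

lemma ad_power_length:
  assumes D: "Vector_Spaces.linear s s D" and DD: "\<And>w. D (D w) = 0"
    and vanish: "\<And>ws. 0 \<in> set ws \<Longrightarrow> f ws = 0" and "ws \<noteq> []"
  shows "(ad D ^^ length ws) f ws
    = s (of_nat (fact (length ws)))
        (f (map D ws) - (\<Sum>i<length ws. D (f ((map D ws)[i := ws ! i]))))"
proof -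
  interpret Vector_Spaces.linear s s D by fact
  define n where "n = length ws"
  obtain m where m: "n = Suc m"
    using assms(4) by (cases n) (auto simp: n_def)
  have L: "(substitute_each D ^^ k) f ws
      = s (of_nat (fact k)) (\<Sum>S | S \<subseteq> {..<n} \<and> card S = k. f (apply_at S D ws))" for k
    unfolding n_def using vanish DD vs1.vector_space_axioms by (rule substitute_each_power)
  have "S = {..<n}" if "S \<subseteq> {..<n}" "card S = n" for S
    using that by (simp add: card_subset_eq)
  then have full: "{S. S \<subseteq> {..<n} \<and> card S = n} = {{..<n}}"
    by auto
  have compl: "\<exists>i<n. {..<n} - S = {i}" if "S \<subseteq> {..<n}" "card S = m" for S
  proof -
    have "card ({..<n} - S) = 1"
      using that m by (simp add: card_Diff_subset finite_subset[OF that(1)])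
    then obtain i where "{..<n} - S = {i}" by (auto simp: card_1_singleton_iff)
    then show ?thesis by (metis Diff_iff insertI1 lessThan_iff)
  qed
  have "(\<Sum>S | S \<subseteq> {..<n} \<and> card S = m. f (apply_at S D ws))
      = (\<Sum>i<n. f (apply_at ({..<n} - {i}) D ws))"
  proof (rule sum.reindex_bij_witness[of _ "\<lambda>i. {..<n} - {i}" "\<lambda>S. the_elem ({..<n} - S)"])
    fix S assume "S \<in> {S. S \<subseteq> {..<n} \<and> card S = m}"
    then have "S \<subseteq> {..<n}" "\<exists>i<n. {..<n} - S = {i}" using compl by auto
    moreover from this have "S = {..<n} - ({..<n} - S)" by auto
    ultimately show "{..<n} - {the_elem ({..<n} - S)} = S" "the_elem ({..<n} - S) \<in> {..<n}"
      "f (apply_at ({..<n} - {the_elem ({..<n} - S)}) D ws) = f (apply_at S D ws)"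
      by auto
  next
    fix i assume "i \<in> {..<n}"
    then have "{..<n} - ({..<n} - {i}) = {i}" by auto
    then show "the_elem ({..<n} - ({..<n} - {i})) = i" by simp
  qed (use m in auto)
  also have "\<dots> = (\<Sum>i<n. f ((map D ws)[i := ws ! i]))"
    by (intro sum.cong refl arg_cong[of _ _ f] nth_equalityI) (auto simp: nth_list_update n_def)
  finally have co: "(\<Sum>S | S \<subseteq> {..<n} \<and> card S = m. f (apply_at S D ws))
    = (\<Sum>i<n. f ((map D ws)[i := ws ! i]))" .
  have "apply_at {..<n} D ws = map D ws"
    by (simp add: list_eq_iff_nth_eq n_def)
  then have Ln: "(substitute_each D ^^ n) f ws = s (of_nat (fact n)) (f (map D ws))"
    by (simp add: L full)
  have Lm: "(substitute_each D ^^ m) f ws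
      = s (of_nat (fact m)) (\<Sum>i<n. f ((map D ws)[i := ws ! i]))"
    by (simp only: L co)
  have fact_n: "(fact n :: nat) = n * fact m"
    by (simp add: m)
  have "s (of_nat n) (D ((substitute_each D ^^ m) f ws))
      = s (of_nat (fact n)) (\<Sum>i<n. D (f ((map D ws)[i := ws ! i])))"
    by (simp add: Lm scale sum fact_n flip: of_nat_mult)
  moreover have "(ad D ^^ n) f ws
      = (substitute_each D ^^ n) f ws - s (of_nat n) (D ((substitute_each D ^^ m) f ws))"
    unfolding m by (rule ad_power) (unfold_locales, auto simp: add scale DD)
  ultimately show ?thesis
    by (simp add: Ln vs1.scale_right_diff_distrib flip: n_def)
qed

section \<open>The bracket between degrees one and zero\<close>

definition degree_one :: "nat \<Rightarrow> ('w list \<Rightarrow> 'u::zero) \<Rightarrow> ('w, 'u) graded" where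
  "degree_one n f = homogeneous 1 (\<lambda>Xs w. if blocks n 1 Xs then f (hd Xs @ [w]) else 0)"

definition degree_zero :: "('w \<Rightarrow> 'u::zero) \<Rightarrow> ('w, 'u) graded" where
  "degree_zero D = homogeneous 0 (\<lambda>Xs w. if Xs = [] then D w else 0)"

lemma shuffle_perms_trivial:
  "shuffle_perms 0 0 = {id}" "shuffle_perms (Suc 0) 0 = {id}" "shuffle_perms 0 (Suc 0) = {id}"
  by (auto simp: shuffle_perms_def strict_mono_on_def)

lemma blocks_Suc_0: "blocks n (Suc 0) Xs \<longleftrightarrow> (\<exists>X. Xs = [X] \<and> length X = n - 1)"
  by (cases Xs) (auto simp: blocks_def)

lemma circ_zero_left:
  assumes "vector_space s"
  shows "circ n s p q 0 Q = 0"
proof -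
  interpret vector_space s by fact
  show ?thesis by (simp add: circ_def fun_eq_iff Let_def)
qed

text \<open>
  Both shuffle sums have only the identity as index here. The insertions of \<open>D\<close> into the block and
  into the last argument of \<open>f\<close> together give the sum over all \<open>n\<close> positions, and the composition
  in the other order gives \<open>D (f ws)\<close>. The bracket of two families also contains products with
  their zero components; these vanish by additivity.
\<close>

lemma nLie_bracket_degree_one:
  fixes f :: "'w::ab_group_add list \<Rightarrow> 'w"
  assumes s: "vector_space s" and "1 \<le> n" and f: "multiadditive f" and D: "additive D"
  shows "nLie_bracket n s (degree_one n f) (degree_zero D) = degree_one n (ad D f)"
proof -
  interpret vector_space s by fact
  interpret D: additive D by fact
  define F where "F = (\<lambda>Xs w. if blocks n 1 Xs then f (hd Xs @ [w]) else 0)"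
  define G where "G = (\<lambda>(Xs :: 'w list list) w. if Xs = [] then D w else 0)"
  have F0: "F [X] w = 0" if "0 \<in> set X \<or> w = 0" for X w
    using that multiadditive_zero[OF f] by (auto simp: F_def)
  have FG: "hom_bracket n s 1 0 F G = (\<lambda>Xs w. if blocks n 1 Xs then ad D f (hd Xs @ [w]) else 0)"
  proof (intro ext)
    fix Xs w
    show "hom_bracket n s 1 0 F G Xs w = (if blocks n 1 Xs then ad D f (hd Xs @ [w]) else 0)"
    proof (cases "blocks n 1 Xs")
      case True
      then obtain X where X: "Xs = [X]" "length X = n - 1" by (auto simp: blocks_Suc_0)
      have "ad D f (X @ [w]) = (\<Sum>i<n - 1. f (X[i := D (X ! i)] @ [w])) + f (X @ [D w]) - D (f (X @ [w]))"
        using X by (simp add: ad_def substitute_each_def nth_append list_update_append)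
      then show ?thesis
        using True X
        by (simp add: hom_bracket_def circ_def shuffle_perms_trivial F_def G_def blocks_Suc_0 sign_id)
    next
      case False
      then show ?thesis by (simp add: hom_bracket_def circ_def)
    qed
  qed
  have F_zero: "circ n s 1 q F 0 = 0" for q
  proof (intro ext)
    fix Xs w
    show "circ n s 1 q F 0 Xs w = 0 Xs w"
    proof (cases "blocks n (1 + q) Xs")
      case True
      then have "length (Xs ! q) = n - 1" by (auto simp: blocks_def)
      then show ?thesis
        by (auto simp: circ_def F0 set_update_memI)
    qed (simp add: circ_def)
  qed
  have G_zero: "circ n s 0 p G 0 = 0" for p
    by (auto simp: circ_def fun_eq_iff G_def D.zero)
  have "(\<Sum>p\<le>r. hom_bracket n s p (r - p) (degree_one n f p) (degree_zero D (r - p))) = degree_one n (ad D f) r" for r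
  proof -
    have off: "hom_bracket n s p q (degree_one n f p) (degree_zero D q) = 0" if "p \<noteq> 1 \<or> q \<noteq> 0" for p q
    proof -
      have deg: "degree_one n f p = (if p = 1 then F else 0)" "degree_zero D q = (if q = 0 then G else 0)"
        by (simp_all add: degree_one_def degree_zero_def homogeneous_def F_def G_def)
      show ?thesis
        using that unfolding deg
        by (auto simp: hom_bracket_def fun_eq_iff circ_zero_left[OF s] F_zero[simplified] G_zero)
    qed
    show ?thesis
    proof (cases "r = 1")
      case True
      then show ?thesis using off[of 0 1] FG
        by (simp add: degree_one_def degree_zero_def homogeneous_def F_def G_def)
    next
      case False
      then have "hom_bracket n s p (r - p) (degree_one n f p) (degree_zero D (r - p)) = 0" if "p \<le> r" for p
        using that by (intro off) auto
      then show ?thesis using False by (simp add: degree_one_def homogeneous_def)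
    qed
  qed
  then show ?thesis by (simp add: nLie_bracket_def fun_eq_iff)
qed

lemma foldl_nLie_bracket_replicate:
  assumes "vector_space s" "1 \<le> n" "multiadditive f" "additive D"
  shows "foldl (nLie_bracket n s) (degree_one n f) (replicate k (degree_zero D)) = degree_one n ((ad D ^^ k) f)"
  using assms(3)
  by (induction k arbitrary: f)
    (simp_all add: nLie_bracket_degree_one[OF assms(1,2) _ assms(4)] multiadditive_ad[OF _ assms(4)] funpow_swap1)

section \<open>The semidirect product and the Rota-Baxter defect\<close>

definition embed_operator :: "('v \<Rightarrow> 'g) \<Rightarrow> 'g \<times> 'v \<Rightarrow> 'g \<times> 'v::zero" where
  "embed_operator T w = (T (snd w), 0)"

lemma linear_element_eq: "linear_element T = degree_zero (embed_operator T)"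
  by (auto simp: linear_element_def degree_zero_def embed_cochain_def embed_operator_def fun_eq_iff homogeneous_def
     zero_prod_def)

definition semidirect_map ::
  "nat \<Rightarrow> ('g::ab_group_add list \<Rightarrow> 'g) \<Rightarrow> ('k::field \<Rightarrow> 'v::ab_group_add \<Rightarrow> 'v) \<Rightarrow>
   ('g list \<Rightarrow> 'v \<Rightarrow> 'v) \<Rightarrow> ('g \<times> 'v) list \<Rightarrow> 'g \<times> 'v"
where
  "semidirect_map n mu sv rho ws =
     (if length ws = n then
        (mu (map fst ws),
         \<Sum>i<n. sv ((-1) ^ (n - Suc i)) (rho (omit i (map fst ws)) (snd (ws ! i))))
      else 0)"

lemma semidirect_eq:
  assumes "1 \<le> n"
  shows "semidirect n mu sv rho = degree_one n (semidirect_map n mu sv rho)"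
  unfolding semidirect_def degree_one_def
  using assms by (intro arg_cong[of _ _ "homogeneous 1"] ext) (auto simp: semidirect_map_def blocks_Suc_0 Let_def)

text \<open>
  Omitting a position before \<open>i\<close> moves position \<open>i\<close> down by one.
\<close>

lemma omit_update:
  assumes "i \<noteq> j" "i < length xs" "j < length xs"
  shows "omit j (xs[i := x]) = (omit j xs)[(if i < j then i else i - 1) := x]"
  using assms
  by (auto simp: omit_def list_update_append take_update_swap drop_update_swap list_update_beyond Suc_le_eq min_def
     Suc_diff_Suc)

lemma omit_update_same: "omit i (xs[i := x]) = omit i xs"
  by (simp add: omit_def)

lemma length_omit: "i < length xs \<Longrightarrow> length (omit i xs) = length xs - 1"
  by (simp add: omit_def)

lemma alt_multilinear_add:
  assumes "alt_multilinear sa sb m f" "length xs = m" "i < m"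
  shows "f (xs[i := x + y]) = f (xs[i := x]) + f (xs[i := y])"
proof -
  interpret Vector_Spaces.linear sa sb "\<lambda>y. f (xs[i := y])"
    using assms by (simp add: alt_multilinear_def)
  show ?thesis by (rule add)
qed

text \<open>
  In the \<open>j\<close>-th summand of the \<open>V\<close>-component, the \<open>i\<close>-th argument enters as a vector if \<open>j = i\<close>
  and as an argument of the alternating map \<open>\<rho>\<close> otherwise; both dependences are additive.
\<close>

lemma multiadditive_semidirect_map:
  fixes mu :: "'g::ab_group_add list \<Rightarrow> 'g" and rho :: "'g list \<Rightarrow> 'v::ab_group_add \<Rightarrow> 'v"
  assumes "n_LieRep_pair n sg mu sv rho"
  shows "multiadditive (semidirect_map n mu sv rho)"
  unfolding multiadditive_def
proof (intro allI impI)
  fix ws :: "('g \<times> 'v) list" and i x y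
  assume i: "i < length ws"
  have mu: "alt_multilinear sg sg n mu" and sv: "vector_space sv"
    and rho: "length xs = n - 1 \<Longrightarrow> Vector_Spaces.linear sv sv (rho xs)"
      "alt_multilinear sg sv (n - 1) (\<lambda>xs. rho xs v)" for xs v
    using assms by (auto simp: n_LieRep_pair_def n_Lie_algebra_def n_Lie_representation_def)
  interpret vector_space sv by fact
  show "semidirect_map n mu sv rho (ws[i := x + y])
      = semidirect_map n mu sv rho (ws[i := x]) + semidirect_map n mu sv rho (ws[i := y])"
  proof (cases "length ws = n")
    case True
    let ?t = "\<lambda>j z. rho (omit j (map fst (ws[i := z]))) (snd (ws[i := z] ! j))"
    have "?t j (x + y) = ?t j x + ?t j y" if j: "j < n" for j
    proof (cases "j = i")
      case True
      interpret r: Vector_Spaces.linear sv sv "rho (omit i (map fst ws))"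
        using i \<open>length ws = n\<close> by (intro rho(1)) (simp add: length_omit)
      show ?thesis using True i by (simp add: map_update omit_update_same r.add)
    next
      case False
      then show ?thesis using i j True
        by (auto simp: map_update omit_update length_omit intro!: alt_multilinear_add[OF rho(2)])
    qed
    moreover have "mu (map fst (ws[i := x + y])) = mu (map fst (ws[i := x])) + mu (map fst (ws[i := y]))"
      using alt_multilinear_add[OF mu, of "map fst ws" i "fst x" "fst y"] i True by (simp add: map_update)
    ultimately show ?thesis
      by (simp add: semidirect_map_def True scale_right_distrib sum.distrib)
  qed (simp add: semidirect_map_def)
qed

definition Rota_Baxter_defect ::
  "nat \<Rightarrow> ('k::field \<Rightarrow> 'g::ab_group_add \<Rightarrow> 'g) \<Rightarrow> ('g list \<Rightarrow> 'g) \<Rightarrow>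
   ('g list \<Rightarrow> 'v \<Rightarrow> 'v) \<Rightarrow> ('v \<Rightarrow> 'g) \<Rightarrow> 'v list \<Rightarrow> 'g"
where
  "Rota_Baxter_defect n sg mu rho T vs =
     mu (map T vs) - (\<Sum>i<n. sg ((-1) ^ (n - Suc i)) (T (rho (omit i (map T vs)) (vs ! i))))"

lemma linear_embed_operator:
  assumes "Vector_Spaces.linear sv sg T"
  shows "Vector_Spaces.linear (module_prod.scale sg sv) (module_prod.scale sg sv) (embed_operator T)"
proof -
  interpret Vector_Spaces.linear sv sg T by fact
  interpret vector_space_prod sg sv ..
  show ?thesis
    unfolding Vector_Spaces.linear_iff
    by (auto simp: p.vector_space_axioms embed_operator_def scale_def add scale)
qed

text \<open>
  The operator \<open>embed_operator T\<close> takes values in \<open>\<gg>\<close>, so an argument that it has hit has no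
  \<open>V\<close>-component. Hence \<open>\<rho>\<close> does not contribute when all arguments are hit, and when
  the \<open>i\<close>-th one is spared, only the summand in which it is the vector acted upon remains.
\<close>

lemma ad_power_semidirect_map:
  assumes pair: "n_LieRep_pair n sg mu sv rho" and T: "Vector_Spaces.linear sv sg T"
    and n: "1 \<le> n" and ws: "length ws = n"
  shows "(ad (embed_operator T) ^^ n) (semidirect_map n mu sv rho) ws
    = module_prod.scale sg sv (of_nat (fact n)) (Rota_Baxter_defect n sg mu rho T (map snd ws), 0)"
proof -
  interpret T: Vector_Spaces.linear sv sg T by fact
  let ?D = "embed_operator T" and ?f = "semidirect_map n mu sv rho" and ?vs = "map snd ws"
  have rho0: "rho xs 0 = 0" if "length xs = n - 1" for xs
  proof -
    interpret r: Vector_Spaces.linear sv sv "rho xs"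
      using pair that by (auto simp: n_LieRep_pair_def n_Lie_representation_def)
    show ?thesis by (rule r.zero)
  qed
  have DD: "?D (?D w) = 0" for w
    by (simp add: embed_operator_def T.zero zero_prod_def)
  have ne: "ws \<noteq> []"
    using n ws by auto
  have fstD: "map fst (map ?D ws) = map T ?vs"
    by (simp add: embed_operator_def)
  have "?f (map ?D ws) = (mu (map T ?vs), 0)"
    unfolding semidirect_map_def fstD
    by (simp add: ws embed_operator_def rho0 length_omit)
  moreover have "?D (?f ((map ?D ws)[i := ws ! i]))
      = (sg ((-1) ^ (n - Suc i)) (T (rho (omit i (map T ?vs)) (?vs ! i))), 0)" if i: "i < n" for i
  proof -
    let ?us = "(map ?D ws)[i := ws ! i]"
    have us: "map fst ?us = (map T ?vs)[i := fst (ws ! i)]"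
      unfolding map_update fstD ..
    have "snd (?f ?us) = (\<Sum>j<n. sv ((-1) ^ (n - Suc j)) (rho (omit j (map fst ?us)) (snd (?us ! j))))"
      by (simp add: semidirect_map_def ws)
    also have "\<dots> = (\<Sum>j<n. if j = i then sv ((-1) ^ (n - Suc i)) (rho (omit i (map fst ?us)) (snd (?us ! i))) else 0)"
      by (intro sum.cong refl) (auto simp: ws rho0 length_omit embed_operator_def)
    also have "\<dots> = sv ((-1) ^ (n - Suc i)) (rho (omit i (map T ?vs)) (?vs ! i))"
      using i unfolding us by (simp add: omit_update_same ws)
    finally show ?thesis by (simp add: embed_operator_def T.scale)
  qed
  ultimately have "?f (map ?D ws) - (\<Sum>i<n. ?D (?f ((map ?D ws)[i := ws ! i])))
      = (Rota_Baxter_defect n sg mu rho T ?vs, 0)"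
    by (simp add: Rota_Baxter_defect_def ws sum_prod)
  moreover have "(ad ?D ^^ n) ?f ws = module_prod.scale sg sv (of_nat (fact n))
      (?f (map ?D ws) - (\<Sum>i<n. ?D (?f ((map ?D ws)[i := ws ! i]))))"
    using ad_power_length[where f = ?f, OF linear_embed_operator[OF T] DD
        multiadditive_zero[OF multiadditive_semidirect_map[OF pair]] ne]
    unfolding ws by blast
  ultimately show ?thesis by simp
qed

section \<open>The twisted Maurer-Cartan equation\<close>

text \<open>
  The coefficient \<open>1 / (k! (n - k)!)\<close> of the \<open>k\<close>-th term is \<open>1 / n!\<close> times a binomial
  coefficient, so the sum is the expansion of \<open>ad\<close> of the operator of \<open>T + T'\<close> to the power \<open>n\<close>,
  divided by \<open>n!\<close>. The sum starts at \<open>k = 1\<close>; the missing term \<open>k = 0\<close> is the \<open>n\<close>-th power for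
  \<open>T\<close> alone, which appears as the subtracted defect.
\<close>

lemma twisted_Maurer_Cartan_sum:
  fixes sg :: "'k::field_char_0 \<Rightarrow> 'g::ab_group_add \<Rightarrow> 'g"
    and sv :: "'k \<Rightarrow> 'v::ab_group_add \<Rightarrow> 'v"
  assumes pair: "n_LieRep_pair n sg mu sv rho" and n: "1 \<le> n"
    and T: "Vector_Spaces.linear sv sg T" and T': "Vector_Spaces.linear sv sg T'"
  shows "(\<Sum>k = 1..n. graded_scale (module_prod.scale sg sv) (1 / fact k)
       (twisted_bracket n sg mu sv rho T k (replicate k (linear_element T'))))
    = degree_one n (\<lambda>ws. if length ws = n then
        (Rota_Baxter_defect n sg mu rho (\<lambda>v. T v + T' v) (map snd ws)
          - Rota_Baxter_defect n sg mu rho T (map snd ws), 0) else 0)"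
  (is "?lhs = degree_one n ?h")
proof -
  interpret T: Vector_Spaces.linear sv sg T by fact
  interpret T': Vector_Spaces.linear sv sg T' by fact
  interpret vector_space_prod sg sv ..
  let ?D = "embed_operator T'" and ?E = "embed_operator T" and ?f = "semidirect_map n mu sv rho"
  let ?g = "\<lambda>k. (ad ?D ^^ k) ((ad ?E ^^ (n - k)) ?f)"
  have f: "multiadditive ?f" using pair by (rule multiadditive_semidirect_map)
  note lin = linear_embed_operator[OF T'] linear_embed_operator[OF T]
  have add: "additive ?D" "additive ?E"
    by (auto simp: additive_def embed_operator_def T.add T'.add)
  have bracket: "n_bracket n sg mu sv rho (replicate (n - k) (linear_element T) @ replicate k (linear_element T'))
      = degree_one n (?g k)" for k
    by (simp add: n_bracket_def semidirect_eq[OF n] linear_element_eq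
        foldl_nLie_bracket_replicate[OF p.vector_space_axioms n] f add multiadditive_ad_power)
  have lhs: "?lhs p Xs x = (\<Sum>k=1..n. scale (1 / fact k) (scale (1 / fact (n - k)) (degree_one n (?g k) p Xs x)))" for p Xs x
    by (auto simp: sum_apply twisted_bracket_def graded_scale_def bracket intro!: sum.cong)
  have key: "(\<Sum>k=1..n. scale (1 / fact k) (scale (1 / fact (n - k)) (?g k ws))) = ?h ws"
    if ws: "length ws = n" for ws
  proof -
    have sum_op: "(\<lambda>w. ?D w + ?E w) = embed_operator (\<lambda>v. T v + T' v)"
      by (auto simp: embed_operator_def add_ac)
    have TT': "Vector_Spaces.linear sv sg (\<lambda>v. T v + T' v)"
      using T T' by (auto simp: Vector_Spaces.linear_iff T.vs2.scale_right_distrib algebra_simps)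
    have "scale (fact n) (\<Sum>k=1..n. scale (1 / fact k) (scale (1 / fact (n - k)) (?g k ws)))
        = (\<Sum>k=1..n. scale (of_nat (n choose k)) (?g k ws))"
      unfolding p.scale_sum_right p.scale_scale
      by (intro sum.cong refl) (simp add: binomial_fact)
    also have "\<dots> = (\<Sum>k\<le>n. scale (of_nat (n choose k)) (?g k ws)) - ?g 0 ws"
      by (simp add: sum.atMost_shift lessThan_atLeast0 atMost_atLeast0 sum.atLeast_Suc_atMost)
    also have "(\<Sum>k\<le>n. scale (of_nat (n choose k)) (?g k ws)) = (ad (embed_operator (\<lambda>v. T v + T' v)) ^^ n) ?f ws"
      unfolding sum_op[symmetric]
      by (rule ad_add_power[OF f lin, symmetric]) (simp add: embed_operator_def T.zero T'.zero)
    also have "\<dots> - ?g 0 ws = scale (fact n) (?h ws)"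
      using ad_power_semidirect_map[OF pair TT' n ws] ad_power_semidirect_map[OF pair T n ws]
      by (simp add: ws flip: p.scale_right_diff_distrib)
    finally show ?thesis by simp
  qed
  show ?thesis
  proof (intro ext)
    fix p Xs x
    have val: "degree_one n g p Xs x = (if p = 1 \<and> blocks n 1 Xs then g (hd Xs @ [x]) else 0)"
      for g :: "('g \<times> 'v) list \<Rightarrow> 'g \<times> 'v"
      by (simp add: degree_one_def homogeneous_def)
    show "?lhs p Xs x = degree_one n ?h p Xs x"
    proof (cases "p = 1 \<and> blocks n 1 Xs")
      case True
      then have "length (hd Xs @ [x]) = n"
        using n by (auto simp: blocks_Suc_0)
      then show ?thesis
        unfolding lhs val if_P[OF True] by (rule key)
    next
      case False
      then show ?thesis
        unfolding lhs val if_not_P[OF False] by simp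
    qed
  qed
qed

lemma degree_one_eq_0_iff:
  assumes "1 \<le> n"
  shows "degree_one n f = 0 \<longleftrightarrow> (\<forall>ws. length ws = n \<longrightarrow> f ws = 0)"
proof
  assume eq: "degree_one n f = 0"
  show "\<forall>ws. length ws = n \<longrightarrow> f ws = 0"
  proof (intro allI impI)
    fix ws :: "'a list" assume "length ws = n"
    moreover from this assms have "ws = butlast ws @ [last ws]" by (cases ws) auto
    moreover have "degree_one n f 1 [butlast ws] (last ws) = 0" by (simp add: eq)
    ultimately show "f ws = 0"
      by (simp add: degree_one_def homogeneous_def blocks_Suc_0)
  qed
qed (use assms in \<open>auto simp: degree_one_def homogeneous_def blocks_Suc_0 fun_eq_iff\<close>)

lemma linear_element_in_C_star:
  assumes "Vector_Spaces.linear sv sg T"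
  shows "linear_element T \<in> C_star n sg sv 0"
  unfolding linear_element_def C_star_def
  using assms by (intro imageI) (auto simp: cochains_def blocks_def)

text \<open>
  The twisted brackets vanish from \<open>n + 1\<close> on, so the series over all \<open>k\<close> is the finite sum.
\<close>

lemma Maurer_Cartan_element_twisted_iff:
  assumes "linear_element T' \<in> C_star n sg sv 0" and s: "vector_space (module_prod.scale sg sv)"
  shows "Maurer_Cartan_element (graded_scale (module_prod.scale sg sv)) (C_star n sg sv)
       (twisted_bracket n sg mu sv rho T) (linear_element T')
    \<longleftrightarrow> (\<Sum>k = 1..n. graded_scale (module_prod.scale sg sv) (1 / fact k)
           (twisted_bracket n sg mu sv rho T k (replicate k (linear_element T')))) = 0"
proof -
  interpret vector_space "module_prod.scale sg sv" by fact
  define t where "t k = graded_scale (module_prod.scale sg sv) (1 / fact k)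
           (twisted_bracket n sg mu sv rho T k (replicate k (linear_element T')))" for k
  have "t k = 0" if "n < k" for k
    using that by (simp add: t_def twisted_bracket_def graded_scale_def fun_eq_iff)
  then have K: "{k. 1 \<le> k \<and> t k \<noteq> 0} \<subseteq> {1..n}"
    by (auto simp: not_less[symmetric])
  then have "finite {k. 1 \<le> k \<and> t k \<noteq> 0}"
    by (rule finite_subset) simp
  moreover have "sum t {k. 1 \<le> k \<and> t k \<noteq> 0} = sum t {1..n}"
    using K by (intro sum.mono_neutral_left) auto
  ultimately show ?thesis
    using assms(1) by (simp add: Maurer_Cartan_element_def Let_def flip: t_def)
qed

theorem theorem3p12:
  fixes n :: nat
    and sg :: "'k::{alg_closed_field, field_char_0} \<Rightarrow> 'g::ab_group_add \<Rightarrow> 'g"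
    and sv :: "'k \<Rightarrow> 'v::ab_group_add \<Rightarrow> 'v"
    and Bg :: "'g set" and Bv :: "'v set"
    and mu :: "'g list \<Rightarrow> 'g"
    and rho :: "'g list \<Rightarrow> 'v \<Rightarrow> 'v"
    and T T' :: "'v \<Rightarrow> 'g"
  assumes "2 \<le> n"
    and "finite_dimensional_vector_space sg Bg"
    and "finite_dimensional_vector_space sv Bv"
    and "n_LieRep_pair n sg mu sv rho"
    and "relative_Rota_Baxter n sg mu sv rho T"
    and "Vector_Spaces.linear sv sg T'"
  shows "(relative_Rota_Baxter n sg mu sv rho (\<lambda>v. T v + T' v) \<longleftrightarrow>
            Maurer_Cartan_element (graded_scale (module_prod.scale sg sv)) (C_star n sg sv)
              (twisted_bracket n sg mu sv rho T) (linear_element T'))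
       \<and> (Maurer_Cartan_element (graded_scale (module_prod.scale sg sv)) (C_star n sg sv)
              (twisted_bracket n sg mu sv rho T) (linear_element T') \<longleftrightarrow>
            (\<Sum>k = 1..n. graded_scale (module_prod.scale sg sv) (1 / fact k)
               (twisted_bracket n sg mu sv rho T k (replicate k (linear_element T')))) = 0)"
proof -
  have n: "1 \<le> n" using \<open>2 \<le> n\<close> by simp
  have T: "Vector_Spaces.linear sv sg T"
    using assms(5) by (simp add: relative_Rota_Baxter_def)
  note T' = assms(6)
  interpret T: Vector_Spaces.linear sv sg T by fact
  interpret vector_space_prod sg sv ..
  have TT': "Vector_Spaces.linear sv sg (\<lambda>v. T v + T' v)"
    using T T' by (auto simp: Vector_Spaces.linear_iff T.vs2.scale_right_distrib algebra_simps)
  have RB: "relative_Rota_Baxter n sg mu sv rho S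
      \<longleftrightarrow> (\<forall>vs. length vs = n \<longrightarrow> Rota_Baxter_defect n sg mu rho S vs = 0)"
    if "Vector_Spaces.linear sv sg S" for S
    using that by (simp add: relative_Rota_Baxter_def Rota_Baxter_defect_def)
  let ?\<delta> = "Rota_Baxter_defect n sg mu rho"
  have "(\<Sum>k = 1..n. graded_scale scale (1 / fact k)
        (twisted_bracket n sg mu sv rho T k (replicate k (linear_element T')))) = 0
      \<longleftrightarrow> (\<forall>ws :: ('g \<times> 'v) list. length ws = n \<longrightarrow>
            ?\<delta> (\<lambda>v. T v + T' v) (map snd ws) - ?\<delta> T (map snd ws) = 0)"
    unfolding twisted_Maurer_Cartan_sum[OF assms(4) n T T'] degree_one_eq_0_iff[OF n]
    by (simp add: zero_prod_def)
  also have "\<dots> \<longleftrightarrow> (\<forall>vs. length vs = n \<longrightarrow> ?\<delta> (\<lambda>v. T v + T' v) vs - ?\<delta> T vs = 0)"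
  proof (intro iffI allI impI)
    fix vs :: "'v list"
    assume H: "\<forall>ws :: ('g \<times> 'v) list. length ws = n \<longrightarrow>
      ?\<delta> (\<lambda>v. T v + T' v) (map snd ws) - ?\<delta> T (map snd ws) = 0" and "length vs = n"
    \<comment> \<open>The defect depends on the \<open>V\<close>-components alone, so zeros can be put into \<open>\<gg>\<close>.\<close>
    then show "?\<delta> (\<lambda>v. T v + T' v) vs - ?\<delta> T vs = 0"
      using H[rule_format, of "map (Pair 0) vs"] by (simp add: comp_def)
  qed simp
  also have "\<dots> \<longleftrightarrow> relative_Rota_Baxter n sg mu sv rho (\<lambda>v. T v + T' v)"
    using assms(5) unfolding RB[OF T] RB[OF TT'] by simp
  finally show ?thesis
    using Maurer_Cartan_element_twisted_iff[OF linear_element_in_C_star[OF T'] p.vector_space_axioms]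
    by simp
qed

end
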